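(* Let $k\le n$ be positive integers and let $G$ be a $k$-chromatic graph of order $n$ with maximum degree $\Delta(G)$. Then for every $x\in\mathbb{N}$, $$\pi(G,x)\le (x)_{\downarrow k}\,(x-1)^{\Delta(G)-(k-1)}\,x^{n-1-\Delta(G)}.$$
   Context: All graphs are finite and simple. $\pi(G,x)$ denotes the chromatic polynomial of $G$ (for $x\in\mathbb{N}$ it counts the proper colourings $V(G)\to\{1,\dots,x\}$). $(x)_{\downarrow k}=x(x-1)\cdots(x-k+1)$ is the falling factorial. A graph is $k$-chromatic if its chromatic number is $k$. *)

theory Defs
  imports "Graph_Theory.Digraph" "HOL-Computational_Algebra.Polynomial" "HOL-Library.FuncSet"
begin

text \<open>
  Finite simple graphs are the graphs of \<^locale>\<open>graph\<close>: an edge is represented by a pair of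
  opposite arcs, so the degree of a vertex is its out-degree (equivalently, its in-degree).
\<close>

definition max_degree :: "('a, 'b) pre_digraph \<Rightarrow> nat" where
  "max_degree G = Max (out_degree G ` verts G)"

text \<open>
  Colourings are extensional functions (undefined outside the vertex set), so that each map from
  the vertices to the colours is counted exactly once.
\<close>

definition proper_colourings :: "('a, 'b) pre_digraph \<Rightarrow> nat set \<Rightarrow> ('a \<Rightarrow> nat) set" where
  "proper_colourings G C = {c \<in> verts G \<rightarrow>\<^sub>E C. \<forall>u v. u \<rightarrow>\<^bsub>G\<^esub> v \<longrightarrow> c u \<noteq> c v}"

definition chromatic_number :: "('a, 'b) pre_digraph \<Rightarrow> nat" where
  "chromatic_number G = (LEAST k. proper_colourings G {1..k} \<noteq> {})"

text \<open>
  Existence and uniqueness of the polynomial are established below, see \<open>poly_chromatic_poly\<close> and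
  \<open>chromatic_poly_unique\<close>.
\<close>

definition chromatic_poly :: "('a, 'b) pre_digraph \<Rightarrow> real poly" where
  "chromatic_poly G =
     (THE p. \<forall>x::nat. poly p (of_nat x) = of_nat (card (proper_colourings G {1..x})))"

definition falling_fact :: "'a::comm_ring_1 \<Rightarrow> nat \<Rightarrow> 'a" where
  "falling_fact x k = (\<Prod>i<k. x - of_nat i)"


lemma finite_proper_colourings:
  assumes "finite (verts G)" "finite C"
  shows "finite (proper_colourings G C)"
  unfolding proper_colourings_def using finite_PiE[of "verts G" "\<lambda>_. C"] assms by simp

lemma card_onto_colourings:
  assumes wf: "wf_digraph G" and b: "bij_betw f A B"
  shows "card {c \<in> proper_colourings G A. c ` verts G = A} =
         card {c \<in> proper_colourings G B. c ` verts G = B}"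
proof (rule bij_betw_same_card)
  have adj: "u \<in> verts G \<and> v \<in> verts G" if "u \<rightarrow>\<^bsub>G\<^esub> v" for u v
    using that wf_digraph.adj_in_verts[OF wf] by blast
  have tr: "restrict (g \<circ> c) (verts G) \<in> {c \<in> proper_colourings G Y. c ` verts G = Y}"
    if g: "bij_betw g X Y" and c: "c \<in> {c \<in> proper_colourings G X. c ` verts G = X}" for g c X Y
  proof -
    from c have im: "c ` verts G = X" and p: "\<And>u v. u \<rightarrow>\<^bsub>G\<^esub> v \<Longrightarrow> c u \<noteq> c v"
      by (auto simp: proper_colourings_def)
    have img: "g ` X = Y" and inj: "inj_on g X"
      using g by (auto simp: bij_betw_def)
    have "restrict (g \<circ> c) (verts G) u \<noteq> restrict (g \<circ> c) (verts G) v" if "u \<rightarrow>\<^bsub>G\<^esub> v" for u v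
      using p[OF that] adj[OF that] im inj by (auto simp: inj_on_def)
    moreover have "restrict (g \<circ> c) (verts G) ` verts G = Y"
      using im img by (auto simp: image_image[symmetric])
    ultimately show ?thesis
      by (auto simp: proper_colourings_def)
  qed
  let ?h = "inv_into A f"
  have b': "bij_betw ?h B A" using b by (rule bij_betw_inv_into)
  show "bij_betw (\<lambda>c. restrict (f \<circ> c) (verts G))
      {c \<in> proper_colourings G A. c ` verts G = A}
      {c \<in> proper_colourings G B. c ` verts G = B}"
  proof (rule bij_betw_byWitness[where f' = "\<lambda>c. restrict (?h \<circ> c) (verts G)"])
    show "\<forall>c\<in>{c \<in> proper_colourings G A. c ` verts G = A}.
       restrict (?h \<circ> restrict (f \<circ> c) (verts G)) (verts G) = c"
    proof
      fix c assume c: "c \<in> {c \<in> proper_colourings G A. c ` verts G = A}"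
      show "restrict (?h \<circ> restrict (f \<circ> c) (verts G)) (verts G) = c"
      proof
        fix u show "restrict (?h \<circ> restrict (f \<circ> c) (verts G)) (verts G) u = c u"
          using c b by (auto simp: proper_colourings_def bij_betw_def PiE_def extensional_def)
      qed
    qed
    show "\<forall>c\<in>{c \<in> proper_colourings G B. c ` verts G = B}.
       restrict (f \<circ> restrict (?h \<circ> c) (verts G)) (verts G) = c"
    proof
      fix c assume c: "c \<in> {c \<in> proper_colourings G B. c ` verts G = B}"
      show "restrict (f \<circ> restrict (?h \<circ> c) (verts G)) (verts G) = c"
      proof
        fix u show "restrict (f \<circ> restrict (?h \<circ> c) (verts G)) (verts G) u = c u"
          using c bij_betw_inv_into_right[OF b]
          by (auto simp: proper_colourings_def PiE_def extensional_def)
      qed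
    qed
  qed (intro image_subsetI tr[OF b] tr[OF b'], assumption)+
qed

lemma chromatic_poly_exists:
  assumes wf: "wf_digraph G" and fin: "finite (verts G)"
  shows "\<exists>p::real poly. \<forall>x::nat. poly p (of_nat x) = of_nat (card (proper_colourings G {1..x}))"
proof -
  define onto where "onto A = {c \<in> proper_colourings G A. c ` verts G = A}" for A
  define N where "N j = card (onto {1..j})" for j :: nat
  define n where "n = card (verts G)"
  define q :: "nat \<Rightarrow> real poly"
    where "q j = smult (of_nat (N j) / fact j) (\<Prod>i<j. [:- of_nat i, 1:])" for j
  have q: "poly (q j) (of_nat x) = of_nat (N j) * of_nat (x choose j)" for j x
    by (simp add: q_def poly_prod binomial_gbinomial gbinomial_prod_rev atLeast0LessThan)
  have count: "card (proper_colourings G {1..x}) = (\<Sum>j\<le>n. (x choose j) * N j)" for x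
  proof -
    have finA: "finite A" if "A \<in> Pow {1..x}" for A
      using that finite_subset by blast
    have "proper_colourings G {1..x} = (\<Union>A\<in>Pow {1..x}. onto A)"
    proof (intro equalityI subsetI)
      fix c assume c: "c \<in> proper_colourings G {1..x}"
      then have "c \<in> onto (c ` verts G)" "c ` verts G \<in> Pow {1..x}"
        unfolding onto_def proper_colourings_def PiE_def by auto
      then show "c \<in> (\<Union>A\<in>Pow {1..x}. onto A)" by blast
    next
      fix c assume "c \<in> (\<Union>A\<in>Pow {1..x}. onto A)"
      then obtain A where A: "A \<subseteq> {1..x}" "c \<in> proper_colourings G A" by (auto simp: onto_def)
      have "verts G \<rightarrow>\<^sub>E A \<subseteq> verts G \<rightarrow>\<^sub>E {1..x}" using A(1) by (rule PiE_mono)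
      then show "c \<in> proper_colourings G {1..x}" using A(2) unfolding proper_colourings_def by blast
    qed
    then have "card (proper_colourings G {1..x}) = (\<Sum>A\<in>Pow {1..x}. card (onto A))"
      using finite_proper_colourings[OF fin] finA
      by (subst card_UN_disjoint[symmetric]) (auto simp: onto_def)
    also have "\<dots> = (\<Sum>A\<in>Pow {1..x}. N (card A))"
    proof (rule sum.cong)
      fix A assume "A \<in> Pow {1..x}"
      then have "finite A" by (rule finA)
      then obtain f where "bij_betw f A {1..card A}"
        using finite_same_card_bij[of A "{1..card A}"] by auto
      then show "card (onto A) = N (card A)"
        unfolding onto_def N_def by (rule card_onto_colourings[OF wf])
    qed simp
    also have "\<dots> = (\<Sum>j\<le>x. \<Sum>A | A \<in> Pow {1..x} \<and> card A = j. N (card A))"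
    proof (rule sum.group[symmetric])
      show "card ` Pow {1..x} \<subseteq> {..x}"
        using card_mono[of "{1..x}"] by fastforce
    qed auto
    also have "\<dots> = (\<Sum>j\<le>x. (x choose j) * N j)"
      using n_subsets[of "{1..x}"] by simp
    also have "\<dots> = (\<Sum>j\<le>max x n. (x choose j) * N j)"
      by (rule sum.mono_neutral_left) auto
    also have "\<dots> = (\<Sum>j\<le>n. (x choose j) * N j)"
    proof (rule sum.mono_neutral_right)
      have "N j = 0" if "n < j" for j
      proof -
        have "c ` verts G \<noteq> {1..j}" for c :: "'a \<Rightarrow> nat"
          using card_image_le[OF fin, of c] that unfolding n_def by (metis card_atLeastAtMost diff_Suc_1 not_le)
        then show ?thesis by (simp add: N_def onto_def)
      qed
      then show "\<forall>j\<in>{..max x n} - {..n}. (x choose j) * N j = 0" by auto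
    qed auto
    finally show ?thesis .
  qed
  have "\<forall>x::nat. poly (\<Sum>j\<le>n. q j) (of_nat x) = of_nat (card (proper_colourings G {1..x}))"
    unfolding count poly_sum q by (simp add: mult.commute)
  then show ?thesis by blast
qed

lemma poly_eq_if_eq_on_nat:
  fixes p q :: "real poly"
  assumes "\<And>x::nat. poly p (of_nat x) = poly q (of_nat x)"
  shows "p = q"
proof (rule ccontr)
  assume "p \<noteq> q"
  then have "finite {x. poly (p - q) x = 0}" by (intro poly_roots_finite) simp
  moreover have "range (of_nat :: nat \<Rightarrow> real) \<subseteq> {x. poly (p - q) x = 0}" using assms by auto
  ultimately have "finite (range (of_nat :: nat \<Rightarrow> real))" by (rule rev_finite_subset)
  then show False using range_inj_infinite[of "of_nat :: nat \<Rightarrow> real"] by (simp add: inj_on_def)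
qed

lemma chromatic_poly_unique:
  assumes "\<And>x::nat. poly p (of_nat x) = of_nat (card (proper_colourings G {1..x}))"
  shows "chromatic_poly G = p"
  unfolding chromatic_poly_def using assms by (intro the_equality) (auto intro: poly_eq_if_eq_on_nat)

lemma poly_chromatic_poly:
  assumes "graph G"
  shows "poly (chromatic_poly G) (of_nat x) = of_nat (card (proper_colourings G {1..x}))"
proof -
  interpret graph G by fact
  obtain p :: "real poly" where p: "\<And>x::nat. poly p (of_nat x) = of_nat (card (proper_colourings G {1..x}))"
    using chromatic_poly_exists[OF wf_digraph finite_verts] by blast
  show ?thesis using chromatic_poly_unique[OF p] p by simp
qed


text \<open>
  The next two bounds show that subtractions of natural numbers of the form
  \<open>max_degree G - (chromatic_number G - 1)\<close> and \<open>card (verts G) - 1 - max_degree G\<close> never truncate.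
\<close>

lemma card_neighbours:
  assumes "graph G"
  shows "card {v. u \<rightarrow>\<^bsub>G\<^esub> v} = out_degree G u"
proof -
  interpret graph G by fact
  have "{v. u \<rightarrow>\<^bsub>G\<^esub> v} = head G ` out_arcs G u"
    by (auto simp: arcs_ends_conv out_arcs_def)
  moreover have "inj_on (head G) (out_arcs G u)"
    by (rule inj_onI) (auto simp: out_arcs_def arc_to_ends_def intro: no_multi_arcs)
  ultimately show ?thesis by (simp add: out_degree_def card_image)
qed

lemma max_degree_less_order:
  assumes "graph G" "verts G \<noteq> {}"
  shows "max_degree G < card (verts G)"
proof -
  interpret graph G by fact
  have "out_degree G u < card (verts G)" if "u \<in> verts G" for u
  proof -
    have "{v. u \<rightarrow>\<^bsub>G\<^esub> v} \<subset> verts G"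
      using that adj_not_same adj_in_verts by blast
    then show ?thesis
      unfolding card_neighbours[OF \<open>graph G\<close>, symmetric] by (intro psubset_card_mono) auto
  qed
  then show ?thesis unfolding max_degree_def using assms(2) by (subst Max_less_iff) auto
qed

lemma chromatic_number_le_Suc_max_degree:
  assumes "graph G"
  shows "chromatic_number G \<le> Suc (max_degree G)"
proof -
  interpret graph G by fact
  let ?k = "Suc (max_degree G)"
  have "\<exists>c. c ` S \<subseteq> {1..?k} \<and> (\<forall>u\<in>S. \<forall>v\<in>S. u \<rightarrow>\<^bsub>G\<^esub> v \<longrightarrow> c u \<noteq> c v)" if "S \<subseteq> verts G" for S
    using finite_subset[OF that finite_verts] that
  proof (induction S rule: finite_induct)
    case empty
    then show ?case by simp
  next
    case (insert w S)
    then obtain c where c: "c ` S \<subseteq> {1..?k}" "\<forall>u\<in>S. \<forall>v\<in>S. u \<rightarrow>\<^bsub>G\<^esub> v \<longrightarrow> c u \<noteq> c v" by auto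
    let ?N = "{v. w \<rightarrow>\<^bsub>G\<^esub> v}"
    have finN: "finite ?N"
      by (rule finite_subset[OF _ finite_verts]) (use adj_in_verts in blast)
    have "out_degree G w \<le> max_degree G"
      unfolding max_degree_def using insert.prems by (intro Max_ge) auto
    then have "card (c ` ?N) < card {1..?k}"
      using card_image_le[OF finN, of c] card_neighbours[OF assms, of w] by simp
    then obtain a where a: "a \<in> {1..?k}" "a \<notin> c ` ?N"
      using card_mono[of "c ` ?N" "{1..?k}"] finN by (meson finite_imageI not_le subsetI)
    have "\<forall>u\<in>insert w S. \<forall>v\<in>insert w S. u \<rightarrow>\<^bsub>G\<^esub> v \<longrightarrow> (c(w := a)) u \<noteq> (c(w := a)) v"
      using c(2) a(2) adj_not_same arcs_ends_symmetric[OF sym_arcs] by (auto split: if_splits)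
    moreover have "(c(w := a)) ` insert w S \<subseteq> {1..?k}"
      using c(1) a(1) by (auto split: if_splits)
    ultimately show ?case by blast
  qed
  then obtain c where "c ` verts G \<subseteq> {1..?k}"
    "\<forall>u\<in>verts G. \<forall>v\<in>verts G. u \<rightarrow>\<^bsub>G\<^esub> v \<longrightarrow> c u \<noteq> c v" by blast
  then have c: "\<And>u. u \<in> verts G \<Longrightarrow> c u \<in> {1..?k}"
    "\<And>u v. u \<rightarrow>\<^bsub>G\<^esub> v \<Longrightarrow> c u \<noteq> c v"
    using adj_in_verts by blast+
  have "restrict c (verts G) u \<noteq> restrict c (verts G) v" if "u \<rightarrow>\<^bsub>G\<^esub> v" for u v
    using c(2)[OF that] adj_in_verts[OF that] by simp
  moreover have "restrict c (verts G) \<in> verts G \<rightarrow>\<^sub>E {1..?k}"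
    using c(1) by (intro restrict_PiE_iff[THEN iffD2] ballI)
  ultimately have "restrict c (verts G) \<in> proper_colourings G {1..?k}"
    unfolding proper_colourings_def by blast
  then show ?thesis
    unfolding chromatic_number_def by (intro Least_le) auto
qed

end

theory Submission
  imports Defs
begin

text \<open>
  Fix a vertex \<open>u\<close> of degree \<open>d\<close> and sort the colourings by the colour class \<open>{u} \<union> S\<close> of \<open>u\<close>, where
  \<open>S\<close> avoids the neighbours of \<open>u\<close>. What remains is a graph that still needs \<open>k - 1\<close> colours and is
  coloured with \<open>x - 1\<close> colours, so the crude bound \<open>(y)\<^sub>\<down>\<^sub>j y\<^sup>m\<^sup>-\<^sup>j\<close> for graphs of order \<open>m\<close> that need
  \<open>j\<close> colours applies to it. Summing over \<open>S\<close> with the binomial theorem turns \<open>n - 1 - d\<close> of the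
  factors \<open>x - 1\<close> into factors \<open>x\<close>. The crude bound itself follows by induction: use the same
  argument if \<open>d \<ge> k - 1\<close>, and otherwise remove \<open>u\<close>, which does not make the graph easier to colour.
\<close>

section \<open>Falling factorials and a binomial sum\<close>

lemma falling_fact_Suc: "falling_fact x (Suc k) = x * falling_fact (x - 1) k"
proof -
  have "falling_fact x (Suc k) = x * (\<Prod>i<k. x - of_nat (Suc i))"
    unfolding falling_fact_def by (subst prod.lessThan_Suc_shift) simp
  then show ?thesis by (simp add: falling_fact_def algebra_simps)
qed

text \<open>For natural \<open>x < k\<close> the factor with \<open>i = x\<close> vanishes;
  otherwise every factor is positive.\<close>

lemma falling_fact_nonneg: "0 \<le> falling_fact (real x) k"
proof (cases "x < k")
  case True
  then have "falling_fact (real x) k = 0"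
    unfolding falling_fact_def by (intro prod_zero) auto
  then show ?thesis by simp
next
  case False
  then show ?thesis
    unfolding falling_fact_def by (intro prod_nonneg) auto
qed

text \<open>The binomial theorem indexed by subsets: \<open>S\<close> collects the factors of
  \<open>(1 + y) ^ card R\<close> that contribute their 1.\<close>

lemma sum_Pow_power_card_diff:
  fixes y :: "'b::comm_semiring_1"
  assumes "finite R"
  shows "(\<Sum>S\<in>Pow R. y ^ (card R - card S)) = (1 + y) ^ card R"
proof -
  have "(1 + y) ^ card R = (\<Prod>_\<in>R. 1 + y)" by simp
  also have "\<dots> = (\<Sum>S\<in>Pow R. (\<Prod>_\<in>S. 1) * (\<Prod>_\<in>R - S. y))"
    by (rule prod_add[OF assms])
  also have "\<dots> = (\<Sum>S\<in>Pow R. y ^ (card R - card S))"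
    using assms by (intro sum.cong) (auto simp: card_Diff_subset finite_subset)
  finally show ?thesis by simp
qed

section \<open>Colourings of induced subgraphs\<close>

text \<open>The graph is a fixed relation \<open>E\<close> cut down to \<open>W\<close>, so that
  deleting vertices changes only \<open>W\<close>.\<close>

definition colourings_on :: "('a \<Rightarrow> 'a \<Rightarrow> bool) \<Rightarrow> 'a set \<Rightarrow> nat set \<Rightarrow> ('a \<Rightarrow> nat) set" where
  "colourings_on E W C = {c \<in> W \<rightarrow>\<^sub>E C. \<forall>u\<in>W. \<forall>v\<in>W. E u v \<longrightarrow> c u \<noteq> c v}"

text \<open>A lower bound on the chromatic number, as deletions control no exact value. Palettes are
  arbitrary finite sets, so that dropping a colour needs no renaming.\<close>

definition needs_colours :: "('a \<Rightarrow> 'a \<Rightarrow> bool) \<Rightarrow> 'a set \<Rightarrow> nat \<Rightarrow> bool" where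
  "needs_colours E W k \<longleftrightarrow> (\<forall>C. finite C \<longrightarrow> colourings_on E W C \<noteq> {} \<longrightarrow> k \<le> card C)"

lemma finite_colourings_on: "finite W \<Longrightarrow> finite C \<Longrightarrow> finite (colourings_on E W C)"
  unfolding colourings_on_def using finite_PiE[of W "\<lambda>_. C"] by simp

lemma colourings_on_mono: "C \<subseteq> C' \<Longrightarrow> colourings_on E W C \<subseteq> colourings_on E W C'"
  unfolding colourings_on_def using PiE_mono[of W "\<lambda>_. C" "\<lambda>_. C'"] by blast

lemma restrict_colourings_on:
  assumes "c \<in> colourings_on E W C" "X \<subseteq> W" "c ` X \<subseteq> C'"
  shows "restrict c X \<in> colourings_on E X C'"
proof -
  have "c u \<noteq> c v" if "u \<in> X" "v \<in> X" "E u v" for u v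
    using assms(1,2) that unfolding colourings_on_def by blast
  then show ?thesis using assms(3) by (auto simp: colourings_on_def)
qed

text \<open>Without loops, giving all vertices different colours is proper.\<close>

lemma needs_colours_le_card:
  assumes "irreflp E" "finite W" "needs_colours E W k"
  shows "k \<le> card W"
proof -
  obtain f :: "'a \<Rightarrow> nat" where f: "inj_on f W"
    using finite_imp_inj_to_nat_seg[OF assms(2)] by blast
  have "restrict f W \<in> colourings_on E W (f ` W)"
    using f assms(1) by (auto simp: colourings_on_def inj_on_def irreflp_def)
  then show ?thesis
    using assms(2,3) card_image[OF f] unfolding needs_colours_def by (metis empty_iff finite_imageI)
qed

text \<open>One fresh colour on the independent set \<open>T\<close> extends any colouring of the
  rest.\<close>

lemma needs_colours_Diff_independent:
  assumes "finite W" "needs_colours E W (Suc k)" "\<forall>v\<in>T. \<forall>w\<in>T. \<not> E v w"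
  shows "needs_colours E (W - T) k"
  unfolding needs_colours_def
proof (intro allI impI)
  fix C assume C: "finite C" "colourings_on E (W - T) C \<noteq> {}"
  then obtain c where c: "c \<in> colourings_on E (W - T) C" by blast
  obtain a where a: "a \<notin> C" using C(1) ex_new_if_finite infinite_UNIV_nat by blast
  have "restrict (\<lambda>v. if v \<in> T then a else c v) W \<in> colourings_on E W (insert a C)"
    using c a assms(3) unfolding colourings_on_def by (auto 0 3 simp: PiE_iff)
  then have "Suc k \<le> card (insert a C)"
    using assms(2) C(1) unfolding needs_colours_def by blast
  then show "k \<le> card C" using C(1) a by simp
qed

text \<open>If \<open>k\<close> colours sufficed without \<open>u\<close>, its fewer than
  \<open>k\<close> neighbours would leave one of them free for \<open>u\<close>.\<close>

lemma needs_colours_remove_low_degree: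
  assumes "symp E" "irreflp E" "finite W" "needs_colours E W (Suc k)" "u \<in> W"
    and deg: "card {v \<in> W. E u v} < k"
  shows "needs_colours E (W - {u}) (Suc k)"
  unfolding needs_colours_def
proof (intro allI impI, rule ccontr)
  fix C assume C: "finite C" "colourings_on E (W - {u}) C \<noteq> {}" "\<not> Suc k \<le> card C"
  \<comment> \<open>\<open>C\<close> may be smaller than the neighbourhood of \<open>u\<close>, so
    it is padded to exactly \<open>k\<close> colours.\<close>
  have "infinite (- C)" using C(1) by (simp add: finite_compl)
  then obtain B where "finite B" "card B = k - card C" "B \<subseteq> - C"
    using infinite_arbitrarily_large by blast
  then have "finite (C \<union> B)" "card (C \<union> B) = k"
    using C(1,3) by (auto simp: card_Un_disjoint disjoint_eq_subset_Compl inf_commute)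
  then obtain C' where C': "C \<subseteq> C'" "finite C'" "card C' = k" by blast
  obtain c where c: "c \<in> colourings_on E (W - {u}) C'"
    using C(2) colourings_on_mono[OF C'(1)] by blast
  let ?D = "{v \<in> W. E u v}"
  have "card (c ` ?D) < card C'"
    using deg C'(3) card_image_le[of ?D c] \<open>finite W\<close> by simp
  then have "\<not> C' \<subseteq> c ` ?D"
    using card_mono[of "c ` ?D" C'] \<open>finite W\<close> by auto
  then obtain a where a: "a \<in> C'" "a \<notin> c ` ?D" by blast
  have "c(u := a) \<in> colourings_on E W C'"
    using c a assms(1,2,5) unfolding colourings_on_def
    by (auto simp: PiE_iff extensional_def irreflp_def dest: sympD)
  then have "Suc k \<le> card C'"
    using assms(4) C'(2) unfolding needs_colours_def by blast
  then show False using C'(3) by simp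
qed

section \<open>Splitting by the colour class of a vertex\<close>

text \<open>The crude bound on proper subsets is the hypothesis \<open>bound\<close>, so that the
  lemma serves both inside the induction that proves this bound and after it.\<close>

lemma card_colourings_on_le_if_degree:
  assumes E: "irreflp E" and W: "finite W" and k: "needs_colours E W (Suc k)"
    and u: "u \<in> W" and d: "d = card {v \<in> W. E u v}" "k \<le> d" and C: "finite C"
    and bound: "\<And>X B. X \<subset> W \<Longrightarrow> finite B \<Longrightarrow> needs_colours E X k \<Longrightarrow>
      real (card (colourings_on E X B)) \<le> falling_fact (real (card B)) k * real (card B) ^ (card X - k)"
  shows "real (card (colourings_on E W C)) \<le>
    falling_fact (real (card C)) (Suc k) * (real (card C) - 1) ^ (d - k) * real (card C) ^ (card W - 1 - d)"
proof -
  define x where "x = real (card C)"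
  \<comment> \<open>Besides \<open>u\<close> itself, only vertices of \<open>R\<close> can share its
    colour.\<close>
  define R where "R = W - {u} - {v \<in> W. E u v}"
  define F where "F a S = {c \<in> colourings_on E W C. {v \<in> W. c v = a} = insert u S}" for a S
  have finR: "finite R" using W by (simp add: R_def)
  have cardR: "card R = card W - 1 - d"
    using W u E unfolding R_def d(1)
    by (subst card_Diff_subset) (auto simp: irreflp_def)
  have d_less: "d < card W"
    unfolding d(1) using W u E by (intro psubset_card_mono) (auto simp: irreflp_def)
  have F: "real (card (F a S)) \<le> falling_fact (x - 1) k * ((x - 1) ^ (d - k) * (x - 1) ^ (card R - card S))"
    if a: "a \<in> C" and S: "S \<subseteq> R" for a S
  proof (cases "F a S = {}")
    case True
    \<comment> \<open>The right-hand side must still be nonnegative; \<open>a \<in> C\<close> makes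
      \<open>x - 1\<close> a natural number.\<close>
    have "0 < card C" using a C by (auto simp: card_gt_0_iff)
    then have x: "x - 1 = real (card C - 1)" by (simp add: x_def)
    show ?thesis
      unfolding x True using falling_fact_nonneg[of "card C - 1" k] by simp
  next
    case False
    define X where "X = W - insert u S"
    have "0 < card C" using a C by (auto simp: card_gt_0_iff)
    then have cardB: "real (card (C - {a})) = x - 1" using a C by (simp add: x_def)
    have "u \<notin> S" using S by (auto simp: R_def)
    then have "card X = card W - 1 - card S"
      using W S u finite_subset[OF S finR] unfolding X_def
      by (subst card_Diff_subset) (auto simp: R_def)
    \<comment> \<open>Since \<open>k \<le> d\<close> and \<open>S \<subseteq> R\<close>, no
      subtraction truncates here.\<close>
    then have cardX: "card X - k = (d - k) + (card R - card S)"
      using d(2) d_less card_mono[OF finR S] unfolding cardR by linarith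
    obtain c where c: "c \<in> colourings_on E W C" "{v \<in> W. c v = a} = insert u S"
      using False by (auto simp: F_def)
    have "\<not> E v w" if "v \<in> insert u S" "w \<in> insert u S" for v w
    proof -
      have "v \<in> W" "w \<in> W" "c v = c w" using that unfolding c(2)[symmetric] by simp_all
      then show ?thesis using c(1) unfolding colourings_on_def by blast
    qed
    then have "\<forall>v\<in>insert u S. \<forall>w\<in>insert u S. \<not> E v w" by blast
    then have X: "needs_colours E X k"
      unfolding X_def by (rule needs_colours_Diff_independent[OF W k])
    have class_iff: "v \<in> insert u S \<longleftrightarrow> v \<in> W \<and> c v = a" if "c \<in> F a S" for c v
    proof -
      have "insert u S = {v \<in> W. c v = a}" using that by (simp add: F_def)
      then show ?thesis by simp
    qed
    \<comment> \<open>The class of \<open>a\<close> is known on \<open>F a S\<close>, so a colouring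
      is determined by its values on \<open>X\<close>, where \<open>a\<close> does not
      occur.\<close>
    have "card (F a S) \<le> card (colourings_on E X (C - {a}))"
    proof (rule card_inj_on_le[where f = "\<lambda>c. restrict c X"])
      show "inj_on (\<lambda>c. restrict c X) (F a S)"
      proof (rule inj_onI, rule ext)
        fix c c' v assume c: "c \<in> F a S" "c' \<in> F a S" "restrict c X = restrict c' X"
        consider "v \<in> insert u S" | "v \<in> X" | "v \<notin> W" by (auto simp: X_def)
        then show "c v = c' v"
        proof cases
          case 1
          then show ?thesis using class_iff[OF c(1), of v] class_iff[OF c(2), of v] by simp
        next
          case 2
          then show ?thesis using fun_cong[OF c(3), of v] by simp
        next
          case 3
          then show ?thesis using c(1,2)
            by (simp add: F_def colourings_on_def PiE_iff extensional_def)
        qed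
      qed
      show "(\<lambda>c. restrict c X) ` F a S \<subseteq> colourings_on E X (C - {a})"
      proof (rule image_subsetI, rule restrict_colourings_on)
        fix c assume c: "c \<in> F a S"
        then show "c \<in> colourings_on E W C" by (simp add: F_def)
        show "X \<subseteq> W" by (auto simp: X_def)
        have "c v \<in> C" if "v \<in> W" for v
          using c that by (auto simp: F_def colourings_on_def)
        then show "c ` X \<subseteq> C - {a}"
          using class_iff[OF c] unfolding X_def by blast
      qed
      show "finite (colourings_on E X (C - {a}))"
        using W C by (intro finite_colourings_on) (auto simp: X_def)
    qed
    then have "real (card (F a S)) \<le> real (card (colourings_on E X (C - {a})))" by simp
    also have "\<dots> \<le> falling_fact (x - 1) k * (x - 1) ^ (card X - k)"
      unfolding cardB[symmetric] using u C by (intro bound X) (auto simp: X_def)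
    finally show ?thesis by (simp add: cardX power_add)
  qed
  have "colourings_on E W C \<subseteq> (\<Union>a\<in>C. \<Union>S\<in>Pow R. F a S)"
  proof
    fix c assume c: "c \<in> colourings_on E W C"
    define S where "S = {v \<in> W. c v = c u} - {u}"
    have "c u \<in> C" using c u by (auto simp: colourings_on_def)
    moreover have "S \<subseteq> R"
    proof
      fix v assume "v \<in> S"
      then have v: "v \<in> W" "v \<noteq> u" "c u = c v" by (auto simp: S_def)
      then have "\<not> E u v" using c u unfolding colourings_on_def by blast
      then show "v \<in> R" using v by (simp add: R_def)
    qed
    moreover have "c \<in> F (c u) S" using c u by (auto simp: S_def F_def)
    ultimately show "c \<in> (\<Union>a\<in>C. \<Union>S\<in>Pow R. F a S)" by blast
  qed
  moreover have finF: "finite (F a S)" for a S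
    using finite_colourings_on[OF W C] by (simp add: F_def)
  ultimately have "card (colourings_on E W C) \<le> card (\<Union>a\<in>C. \<Union>S\<in>Pow R. F a S)"
    using C finR by (intro card_mono) auto
  also have "\<dots> \<le> (\<Sum>a\<in>C. card (\<Union>S\<in>Pow R. F a S))"
    by (rule card_UN_le[OF C])
  also have "\<dots> \<le> (\<Sum>a\<in>C. \<Sum>S\<in>Pow R. card (F a S))"
    using finR by (intro sum_mono card_UN_le) simp
  finally have "real (card (colourings_on E W C)) \<le> (\<Sum>a\<in>C. \<Sum>S\<in>Pow R. real (card (F a S)))"
    by (simp flip: of_nat_sum)
  also have "\<dots> \<le> (\<Sum>a\<in>C. \<Sum>S\<in>Pow R.
      falling_fact (x - 1) k * ((x - 1) ^ (d - k) * (x - 1) ^ (card R - card S)))"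
    using F by (intro sum_mono) auto
  \<comment> \<open>The summand does not depend on \<open>a\<close>, which gives the factor
    \<open>x\<close>; the sum over \<open>S\<close> is
    \<open>(1 + (x - 1)) ^ card R\<close>.\<close>
  also have "\<dots> = x * falling_fact (x - 1) k * (x - 1) ^ (d - k) * x ^ card R"
    using sum_Pow_power_card_diff[OF finR, of "x - 1"]
    by (simp add: x_def mult.assoc flip: sum_distrib_left)
  finally show ?thesis
    by (simp add: falling_fact_Suc cardR x_def)
qed

section \<open>The crude bound\<close>

text \<open>The induction on \<open>W\<close> leaves \<open>k\<close> and \<open>C\<close>
  arbitrary, because removing a colour class lowers both the number of needed colours and the
  palette.\<close>

lemma card_colourings_on_le:
  assumes "symp E" "irreflp E" "finite W" "needs_colours E W k" "finite C"
  shows "real (card (colourings_on E W C)) \<le>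
    falling_fact (real (card C)) k * real (card C) ^ (card W - k)"
  using assms(3-)
proof (induction W arbitrary: k C rule: finite_psubset_induct)
  case (psubset W)
  let ?x = "real (card C)"
  show ?case
  proof (cases k)
    case 0
    have "card (colourings_on E W C) \<le> card (W \<rightarrow>\<^sub>E C)"
      using psubset by (intro card_mono finite_PiE) (auto simp: colourings_on_def)
    then show ?thesis
      using psubset.hyps 0 by (simp add: card_funcsetE falling_fact_def flip: of_nat_power)
  next
    case (Suc j)
    have k_le: "Suc j \<le> card W"
      using needs_colours_le_card assms(2) psubset Suc by blast
    then obtain u where u: "u \<in> W" by fastforce
    define d where "d = card {v \<in> W. E u v}"
    have d_less: "d < card W"
      unfolding d_def using psubset.hyps u assms(2)
      by (intro psubset_card_mono) (auto simp: irreflp_def)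
    show ?thesis
    proof (cases "j \<le> d")
      case True
      show ?thesis
      proof (cases "C = {}")
        \<comment> \<open>For the empty palette \<open>?x - 1\<close> is negative and could not be
          replaced by \<open>?x\<close> in the powers.\<close>
        case True
        then have "colourings_on E W C = {}" using u by (auto simp: colourings_on_def)
        then show ?thesis using True falling_fact_nonneg[of 0 k] by simp
      next
        case False
        then have x: "1 \<le> ?x" using psubset.prems(2) by (simp add: Suc_leI card_gt_0_iff)
        have "real (card (colourings_on E W C)) \<le>
            falling_fact ?x (Suc j) * (?x - 1) ^ (d - j) * ?x ^ (card W - 1 - d)"
          using psubset Suc u \<open>j \<le> d\<close> assms(2)
          by (intro card_colourings_on_le_if_degree[where u = u]) (auto simp: d_def)
        also have "\<dots> \<le> falling_fact ?x (Suc j) * ?x ^ (d - j) * ?x ^ (card W - 1 - d)"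
          using x falling_fact_nonneg[of "card C" "Suc j"]
          by (intro mult_right_mono mult_left_mono power_mono) auto
        also have "\<dots> = falling_fact ?x (Suc j) * ?x ^ ((d - j) + (card W - 1 - d))"
          by (simp add: power_add)
        also have "(d - j) + (card W - 1 - d) = card W - k"
          using \<open>j \<le> d\<close> d_less Suc by simp
        finally show ?thesis using Suc by simp
      qed
    next
      case False
      let ?W = "W - {u}"
      have need: "needs_colours E ?W (Suc j)"
        using psubset Suc u False assms(1,2)
        by (intro needs_colours_remove_low_degree) (auto simp: d_def)
      \<comment> \<open>At least \<open>k\<close> vertices remain, so deleting \<open>u\<close>
        lowers the exponent by exactly one; the colour of \<open>u\<close> supplies the missing
        factor \<open>?x\<close>.\<close>
      have "Suc j \<le> card ?W"
        using needs_colours_le_card[OF assms(2) _ need] psubset.hyps by simp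
      then have card: "card W - k = Suc (card ?W - k)"
        using psubset.hyps u Suc by simp
      have "card (colourings_on E W C) \<le> card (colourings_on E ?W C \<times> C)"
      proof (rule card_inj_on_le[where f = "\<lambda>c. (restrict c ?W, c u)"])
        show "inj_on (\<lambda>c. (restrict c ?W, c u)) (colourings_on E W C)"
        proof (rule inj_onI, rule ext)
          fix c c' v
          assume c: "c \<in> colourings_on E W C" "c' \<in> colourings_on E W C"
            "(restrict c ?W, c u) = (restrict c' ?W, c' u)"
          then have "restrict c ?W v = restrict c' ?W v" by simp
          then show "c v = c' v"
            using c by (cases "v \<in> W"; cases "v = u")
              (auto simp: colourings_on_def PiE_iff extensional_def)
        qed
        have "c ` W \<subseteq> C" if "c \<in> colourings_on E W C" for c
          using that by (auto simp: colourings_on_def PiE_iff)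
        then show "(\<lambda>c. (restrict c ?W, c u)) ` colourings_on E W C \<subseteq> colourings_on E ?W C \<times> C"
          using u by (auto intro!: restrict_colourings_on)
        show "finite (colourings_on E ?W C \<times> C)"
          using psubset by (intro finite_cartesian_product finite_colourings_on) auto
      qed
      then have "real (card (colourings_on E W C)) \<le> real (card (colourings_on E ?W C)) * ?x"
        by (simp add: card_cartesian_product flip: of_nat_mult)
      also have "\<dots> \<le> (falling_fact ?x k * ?x ^ (card ?W - k)) * ?x"
        using psubset need Suc u by (intro mult_right_mono psubset.IH) auto
      finally show ?thesis by (simp add: card mult_ac)
    qed
  qed
qed

section \<open>Transfer to the chromatic polynomial\<close>

lemma proper_colourings_eq_colourings_on:
  assumes "wf_digraph G"
  shows "proper_colourings G C = colourings_on (\<lambda>u v. u \<rightarrow>\<^bsub>G\<^esub> v) (verts G) C"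
proof -
  have "(\<forall>u v. u \<rightarrow>\<^bsub>G\<^esub> v \<longrightarrow> c u \<noteq> c v) \<longleftrightarrow>
      (\<forall>u\<in>verts G. \<forall>v\<in>verts G. u \<rightarrow>\<^bsub>G\<^esub> v \<longrightarrow> c u \<noteq> c v)" for c :: "'a \<Rightarrow> nat"
    using wf_digraph.adj_in_verts[OF assms] by blast
  then show ?thesis by (simp add: proper_colourings_def colourings_on_def)
qed

text \<open>The chromatic number only considers palettes \<open>{1..k}\<close>; a bijection renames
  any finite palette to this form.\<close>

lemma needs_colours_chromatic_number:
  assumes "wf_digraph G"
  shows "needs_colours (\<lambda>u v. u \<rightarrow>\<^bsub>G\<^esub> v) (verts G) (chromatic_number G)"
  unfolding needs_colours_def
proof (intro allI impI)
  fix C :: "nat set"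
  let ?E = "\<lambda>u v. u \<rightarrow>\<^bsub>G\<^esub> v"
  assume C: "finite C" "colourings_on ?E (verts G) C \<noteq> {}"
  then obtain c where c: "c \<in> colourings_on ?E (verts G) C" by blast
  obtain f where f: "bij_betw f C {1..card C}"
    using finite_same_card_bij[of C "{1..card C}"] C(1) by auto
  have "f (c u) \<noteq> f (c v)" if "u \<in> verts G" "v \<in> verts G" "?E u v" for u v
    using c that inj_onD[OF bij_betw_imp_inj_on[OF f], of "c u" "c v"]
    unfolding colourings_on_def by blast
  moreover have "f (c u) \<in> {1..card C}" if "u \<in> verts G" for u
    using c that bij_betw_apply[OF f, of "c u"] unfolding colourings_on_def by blast
  ultimately have "restrict (f \<circ> c) (verts G) \<in> colourings_on ?E (verts G) {1..card C}"
    unfolding colourings_on_def by simp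
  then have "proper_colourings G {1..card C} \<noteq> {}"
    unfolding proper_colourings_eq_colourings_on[OF assms] by blast
  then show "chromatic_number G \<le> card C"
    unfolding chromatic_number_def by (rule Least_le)
qed

theorem theorem5:
  fixes G :: "('a, 'b) pre_digraph" and n k x :: nat
  assumes "1 \<le> k" and "k \<le> n"
    and "graph G" and "card (verts G) = n" and "chromatic_number G = k"
  shows "poly (chromatic_poly G) (real x) \<le>
    falling_fact (real x) k * (real x - 1) ^ (max_degree G - (k - 1)) *
    real x ^ (n - 1 - max_degree G)"
proof -
  interpret graph G by fact
  let ?E = "\<lambda>u v. u \<rightarrow>\<^bsub>G\<^esub> v"
  have E: "symp ?E" "irreflp ?E"
    using arcs_ends_symmetric[OF sym_arcs] adj_not_same by (auto intro: sympI irreflpI)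
  have k: "k = Suc (k - 1)" using assms(1) by simp
  have "verts G \<noteq> {}" using assms(1,2,4) by auto
  then have "max_degree G \<in> out_degree G ` verts G"
    unfolding max_degree_def by (intro Max_in) auto
  then obtain u where u: "u \<in> verts G" "max_degree G = out_degree G u" by blast
  have "{v \<in> verts G. ?E u v} = {v. ?E u v}" using adj_in_verts by blast
  then have deg: "max_degree G = card {v \<in> verts G. ?E u v}"
    using u(2) card_neighbours[OF assms(3)] by simp
  \<comment> \<open>The greedy colouring bound supplies the degree condition of the colour class
    lemma for a vertex \<open>u\<close> of maximum degree.\<close>
  have "k - 1 \<le> max_degree G"
    using chromatic_number_le_Suc_max_degree[OF assms(3)] assms(5) by simp
  \<comment> \<open>The crude bound, now proved for all vertex sets, discharges the hypothesis
    \<open>bound\<close>.\<close>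
  then have "real (card (colourings_on ?E (verts G) {1..x})) \<le>
      falling_fact (real (card {1..x})) (Suc (k - 1)) * (real (card {1..x}) - 1) ^ (max_degree G - (k - 1)) *
      real (card {1..x}) ^ (card (verts G) - 1 - max_degree G)"
    using needs_colours_chromatic_number[OF wf_digraph] assms(5) k u(1) deg E
    by (intro card_colourings_on_le_if_degree[where u = u] card_colourings_on_le)
      (auto intro: finite_subset[OF _ finite_verts])
  then show ?thesis
    unfolding poly_chromatic_poly[OF assms(3)] proper_colourings_eq_colourings_on[OF wf_digraph]
    using assms(4) k by simp
qed

end
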